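(* Any non-trivial squandle with $4$ elements is isomorphic \begin{itemize} \item either to the sub-squandle $S_3^2$ of the group squandle of the symmetric group $S_3$ consisting of the identity and the transpositions $(12)$, $(23)$ and $(13)$; \item or to the $4$-element set $P=\{p,q,r,s\}$ with operations of the following form (here $x,y$ are arbitrary elements of $P$, and $\tau$ is the involution of $P$ with $(p)\tau=q$, $(q)\tau=p$, $(r)\tau=r$, $(s)\tau=s$): \begin{align*} & x\lhd r=(x)\tau, && x\lhd y=x\ \text{ if } y\neq r,\\ & r^2=s^2=s, && q^2\in\{p,q,s\},\quad p^2=(q^2)\tau. \end{align*} \end{itemize}
   Context: A squandle is a set $Q$ with a binary operation $\lhd$ and a unary operation $a\mapsto a^2$ for which there is a (necessarily unique) binary operation $\widetilde{\lhd}$ on $Q$ such that for all $a,b,c\in Q$: $(a\lhd b)\lhd c=(a\lhd c)\lhd(b\lhd c)$; $(a\lhd b)\,\widetilde{\lhd}\, b=(a\,\widetilde{\lhd}\, b)\lhd b=a$; $a\lhd a=a$; $a\lhd b^2=(a\lhd b)\lhd b$; $a^2\lhd b=(a\lhd b)^2$. A squandle is trivial if $a\lhd b=a$ for all $a,b$. An isomorphism of squandles is a bijection respecting $\lhd$ and squaring. The group squandle of a group $G$ is $G$ with $a\lhd b=b^{-1}ab$ and $a^2=aa$. A sub-squandle is a subset closed under the operations, with the restricted operations. *)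

theory Defs
  imports "HOL-Algebra.Sym_Groups"
begin

record 'a squandle_sig = "'a partial_object" +
  lhd :: "'a \<Rightarrow> 'a \<Rightarrow> 'a"  (infixl \<open>\<triangleleft>\<index>\<close> 70)
  square :: "'a \<Rightarrow> 'a"  (\<open>sq\<index> _\<close> [81] 80)

definition squandle :: "'a squandle_sig \<Rightarrow> bool" where
  "squandle Q \<longleftrightarrow>
     (\<forall>a\<in>carrier Q. \<forall>b\<in>carrier Q. a \<triangleleft>\<^bsub>Q\<^esub> b \<in> carrier Q) \<and>
     (\<forall>a\<in>carrier Q. sq\<^bsub>Q\<^esub> a \<in> carrier Q) \<and>
     (\<exists>rop :: 'a \<Rightarrow> 'a \<Rightarrow> 'a. \<forall>a\<in>carrier Q. \<forall>b\<in>carrier Q.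
        rop a b \<in> carrier Q \<and> rop (a \<triangleleft>\<^bsub>Q\<^esub> b) b = a \<and> (rop a b) \<triangleleft>\<^bsub>Q\<^esub> b = a) \<and>
     (\<forall>a\<in>carrier Q. \<forall>b\<in>carrier Q. \<forall>c\<in>carrier Q.
        (a \<triangleleft>\<^bsub>Q\<^esub> b) \<triangleleft>\<^bsub>Q\<^esub> c = (a \<triangleleft>\<^bsub>Q\<^esub> c) \<triangleleft>\<^bsub>Q\<^esub> (b \<triangleleft>\<^bsub>Q\<^esub> c)) \<and>
     (\<forall>a\<in>carrier Q. a \<triangleleft>\<^bsub>Q\<^esub> a = a) \<and>
     (\<forall>a\<in>carrier Q. \<forall>b\<in>carrier Q. a \<triangleleft>\<^bsub>Q\<^esub> (sq\<^bsub>Q\<^esub> b) = (a \<triangleleft>\<^bsub>Q\<^esub> b) \<triangleleft>\<^bsub>Q\<^esub> b) \<and>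
     (\<forall>a\<in>carrier Q. \<forall>b\<in>carrier Q. (sq\<^bsub>Q\<^esub> a) \<triangleleft>\<^bsub>Q\<^esub> b = sq\<^bsub>Q\<^esub> (a \<triangleleft>\<^bsub>Q\<^esub> b))"

definition trivial_squandle :: "'a squandle_sig \<Rightarrow> bool" where
  "trivial_squandle Q \<longleftrightarrow> (\<forall>a\<in>carrier Q. \<forall>b\<in>carrier Q. a \<triangleleft>\<^bsub>Q\<^esub> b = a)"

definition squandle_iso :: "'a squandle_sig \<Rightarrow> 'b squandle_sig \<Rightarrow> ('a \<Rightarrow> 'b) set" where
  "squandle_iso Q R = {f. bij_betw f (carrier Q) (carrier R) \<and>
     (\<forall>a\<in>carrier Q. \<forall>b\<in>carrier Q. f (a \<triangleleft>\<^bsub>Q\<^esub> b) = f a \<triangleleft>\<^bsub>R\<^esub> f b) \<and>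
     (\<forall>a\<in>carrier Q. f (sq\<^bsub>Q\<^esub> a) = sq\<^bsub>R\<^esub> (f a))}"

definition squandle_isomorphic :: "'a squandle_sig \<Rightarrow> 'b squandle_sig \<Rightarrow> bool" where
  "squandle_isomorphic Q R \<longleftrightarrow> squandle_iso Q R \<noteq> {}"

definition group_squandle :: "('a, 'm) monoid_scheme \<Rightarrow> 'a squandle_sig" where
  "group_squandle G =
     \<lparr>carrier = carrier G, lhd = (\<lambda>a b. inv\<^bsub>G\<^esub> b \<otimes>\<^bsub>G\<^esub> a \<otimes>\<^bsub>G\<^esub> b), square = (\<lambda>a. a \<otimes>\<^bsub>G\<^esub> a)\<rparr>"

(* The last clause is closure under the inverse of (-) <| b. *)
definition sub_squandle :: "'a set \<Rightarrow> 'a squandle_sig \<Rightarrow> bool" where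
  "sub_squandle H Q \<longleftrightarrow> H \<subseteq> carrier Q \<and>
     (\<forall>a\<in>H. \<forall>b\<in>H. a \<triangleleft>\<^bsub>Q\<^esub> b \<in> H) \<and> (\<forall>a\<in>H. sq\<^bsub>Q\<^esub> a \<in> H) \<and>
     (\<forall>a\<in>carrier Q. \<forall>b\<in>H. a \<triangleleft>\<^bsub>Q\<^esub> b \<in> H \<longrightarrow> a \<in> H)"

(* sym_group composes right-to-left. With left-to-right composition, conjugation by b becomes
   conjugation by its inverse, which agrees on the carrier below, as all its elements
   are self-inverse. *)
definition S3_2 :: "(nat \<Rightarrow> nat) squandle_sig" where
  "S3_2 = (group_squandle (sym_group 3))
     \<lparr>carrier := {id, transpose 1 2, transpose 2 3, transpose 1 3}\<rparr>"

datatype P_elem = P_p | P_q | P_r | P_s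

definition tau :: "P_elem \<Rightarrow> P_elem" where
  "tau = transpose P_p P_q"

definition P_squandle :: "P_elem squandle_sig \<Rightarrow> bool" where
  "P_squandle P \<longleftrightarrow> carrier P = {P_p, P_q, P_r, P_s} \<and>
     (\<forall>x\<in>carrier P. x \<triangleleft>\<^bsub>P\<^esub> P_r = tau x) \<and>
     (\<forall>x\<in>carrier P. \<forall>y\<in>carrier P. y \<noteq> P_r \<longrightarrow> x \<triangleleft>\<^bsub>P\<^esub> y = x) \<and>
     sq\<^bsub>P\<^esub> P_r = P_s \<and> sq\<^bsub>P\<^esub> P_s = P_s \<and>
     sq\<^bsub>P\<^esub> P_q \<in> {P_p, P_q, P_s} \<and> sq\<^bsub>P\<^esub> P_p = tau (sq\<^bsub>P\<^esub> P_q)"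

lemma group_squandle_squandle:
  assumes "group G"
  shows "squandle (group_squandle G)"
proof -
  interpret group G by fact
  have canc: "b \<otimes>\<^bsub>G\<^esub> (inv\<^bsub>G\<^esub> b \<otimes>\<^bsub>G\<^esub> c) = c" "inv\<^bsub>G\<^esub> b \<otimes>\<^bsub>G\<^esub> (b \<otimes>\<^bsub>G\<^esub> c) = c"
    if "b \<in> carrier G" "c \<in> carrier G" for b c
    using that by (simp_all flip: m_assoc)
  show ?thesis
    unfolding squandle_def group_squandle_def
    by (auto simp: inv_mult_group m_assoc canc
        intro!: exI[of _ "\<lambda>a b. b \<otimes>\<^bsub>G\<^esub> a \<otimes>\<^bsub>G\<^esub> inv\<^bsub>G\<^esub> b"])
qed

lemma sub_squandle_squandle:
  assumes Q: "squandle Q" and H: "sub_squandle H Q"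
  shows "squandle (Q\<lparr>carrier := H\<rparr>)"
proof -
  have HQ: "\<And>x. x \<in> H \<Longrightarrow> x \<in> carrier Q"
    using H by (auto simp: sub_squandle_def)
  have "\<exists>rop. \<forall>a\<in>carrier Q. \<forall>b\<in>carrier Q.
      rop a b \<in> carrier Q \<and> rop (a \<triangleleft>\<^bsub>Q\<^esub> b) b = a \<and> (rop a b) \<triangleleft>\<^bsub>Q\<^esub> b = a"
    using Q unfolding squandle_def by (elim conjE)
  then obtain rop where rop': "\<forall>a\<in>carrier Q. \<forall>b\<in>carrier Q.
      rop a b \<in> carrier Q \<and> rop (a \<triangleleft>\<^bsub>Q\<^esub> b) b = a \<and> (rop a b) \<triangleleft>\<^bsub>Q\<^esub> b = a" ..
  then have rop: "rop a b \<in> carrier Q \<and> rop (a \<triangleleft>\<^bsub>Q\<^esub> b) b = a \<and> (rop a b) \<triangleleft>\<^bsub>Q\<^esub> b = a"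
    if "a \<in> carrier Q" "b \<in> carrier Q" for a b
    using that by simp
  have rop_H: "rop a b \<in> H" if "a \<in> H" "b \<in> H" for a b
    using H rop[of a b] that HQ unfolding sub_squandle_def by metis
  have "\<exists>rop. \<forall>a\<in>H. \<forall>b\<in>H. rop a b \<in> H \<and> rop (a \<triangleleft>\<^bsub>Q\<^esub> b) b = a \<and> (rop a b) \<triangleleft>\<^bsub>Q\<^esub> b = a"
    by (intro exI[of _ rop] ballI) (simp add: rop rop_H HQ)
  moreover have "\<forall>a\<in>H. \<forall>b\<in>H. a \<triangleleft>\<^bsub>Q\<^esub> b \<in> H" "\<forall>a\<in>H. sq\<^bsub>Q\<^esub> a \<in> H"
    using H by (simp_all add: sub_squandle_def)
  moreover have "\<forall>a\<in>H. \<forall>b\<in>H. \<forall>c\<in>H. (a \<triangleleft>\<^bsub>Q\<^esub> b) \<triangleleft>\<^bsub>Q\<^esub> c = (a \<triangleleft>\<^bsub>Q\<^esub> c) \<triangleleft>\<^bsub>Q\<^esub> (b \<triangleleft>\<^bsub>Q\<^esub> c)"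
    "\<forall>a\<in>H. a \<triangleleft>\<^bsub>Q\<^esub> a = a"
    "\<forall>a\<in>H. \<forall>b\<in>H. a \<triangleleft>\<^bsub>Q\<^esub> (sq\<^bsub>Q\<^esub> b) = (a \<triangleleft>\<^bsub>Q\<^esub> b) \<triangleleft>\<^bsub>Q\<^esub> b"
    "\<forall>a\<in>H. \<forall>b\<in>H. (sq\<^bsub>Q\<^esub> a) \<triangleleft>\<^bsub>Q\<^esub> b = sq\<^bsub>Q\<^esub> (a \<triangleleft>\<^bsub>Q\<^esub> b)"
    using Q unfolding squandle_def by (elim conjE; blast intro: HQ)+
  moreover have upd: "carrier (Q\<lparr>carrier := H\<rparr>) = H" "lhd (Q\<lparr>carrier := H\<rparr>) = lhd Q"
    "square (Q\<lparr>carrier := H\<rparr>) = square Q"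
    by simp_all
  ultimately show ?thesis
    unfolding squandle_def upd by (intro conjI)
qed

lemma sub_squandle_S3_2: "sub_squandle (carrier S3_2) (group_squandle (sym_group 3))"
proof -
  interpret S: group "sym_group 3" by (rule sym_group_is_group)
  let ?H = "{id, transpose 1 2, transpose 2 3, transpose 1 (3::nat)}"
  have sub: "?H \<subseteq> carrier (sym_group 3)"
    by (auto simp: sym_group_carrier permutes_id intro: permutes_swap_id)
  have invo: "h \<circ> h = id" if "h \<in> ?H" for h using that by auto
  have inv_H: "inv\<^bsub>sym_group 3\<^esub> h = h" if "h \<in> ?H" for h
    using that sub invo[OF that]
    by (intro S.inv_equality) (auto simp: sym_group_mult sym_group_one)
  have triples:
    "transpose 1 2 \<circ> transpose 2 3 \<circ> transpose 1 2 = transpose 1 (3::nat)"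
    "transpose 1 2 \<circ> transpose 1 3 \<circ> transpose 1 2 = transpose 2 (3::nat)"
    "transpose 2 3 \<circ> transpose 1 2 \<circ> transpose 2 3 = transpose 1 (3::nat)"
    "transpose 2 3 \<circ> transpose 1 3 \<circ> transpose 2 3 = transpose 1 (2::nat)"
    "transpose 1 3 \<circ> transpose 1 2 \<circ> transpose 1 3 = transpose 2 (3::nat)"
    "transpose 1 3 \<circ> transpose 2 3 \<circ> transpose 1 3 = transpose 1 (2::nat)"
    by (simp_all add: fun_eq_iff transpose_def)
  have conj: "b \<circ> a \<circ> b \<in> ?H" if "a \<in> ?H" "b \<in> ?H" for a b
    using that by (elim insertE emptyE; hypsubst; simp only: triples transpose_comp_involutory
      comp_id id_comp insert_iff simp_thms)
  have conj_rev: "a \<in> ?H" if "b \<in> ?H" "b \<circ> a \<circ> b \<in> ?H" for a b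
  proof -
    have "b \<circ> (b \<circ> a \<circ> b) \<circ> b = (b \<circ> b) \<circ> a \<circ> (b \<circ> b)" by (simp only: o_assoc)
    then have "b \<circ> (b \<circ> a \<circ> b) \<circ> b = a" using invo[OF that(1)] by simp
    then show ?thesis using conj[OF that(2,1)] by simp
  qed
  have car: "carrier S3_2 = ?H" by (simp add: S3_2_def)
  show ?thesis
    unfolding sub_squandle_def car
  proof (intro conjI ballI impI)
    show "?H \<subseteq> carrier (group_squandle (sym_group 3))"
      using sub by (simp add: group_squandle_def)
  next
    fix a b assume "a \<in> ?H" "b \<in> ?H"
    then show "a \<triangleleft>\<^bsub>group_squandle (sym_group 3)\<^esub> b \<in> ?H"
      using conj[of a b] inv_H[of b] by (simp add: group_squandle_def sym_group_mult)
  next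
    fix a assume "a \<in> ?H"
    then show "sq\<^bsub>group_squandle (sym_group 3)\<^esub> a \<in> ?H"
      using invo[of a] by (simp add: group_squandle_def sym_group_mult)
  next
    fix a b assume "b \<in> ?H" "a \<triangleleft>\<^bsub>group_squandle (sym_group 3)\<^esub> b \<in> ?H"
    then show "a \<in> ?H"
      using conj_rev[of b a] inv_H[of b] by (simp add: group_squandle_def sym_group_mult)
  qed
qed

lemma squandle_S3_2: "squandle S3_2"
  using sub_squandle_squandle[OF group_squandle_squandle[OF sym_group_is_group] sub_squandle_S3_2]
  by (simp add: S3_2_def)

lemma P_squandle_squandle:
  assumes "P_squandle P"
  shows "squandle P"
proof -
  have car: "x \<in> carrier P" for x
    using assms by (cases x) (auto simp: P_squandle_def)
  have op: "x \<triangleleft>\<^bsub>P\<^esub> y = (if y = P_r then tau x else x)" for x y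
    using assms car[of x] car[of y] unfolding P_squandle_def by metis
  have tau: "tau P_p = P_q" "tau P_q = P_p" "tau P_r = P_r" "tau P_s = P_s" "tau (tau x) = x" for x
    by (simp_all add: tau_def)
  have sq_r: "sq\<^bsub>P\<^esub> x \<noteq> P_r" for x
    using assms by (cases x) (auto simp: P_squandle_def tau)
  have sq_tau: "sq\<^bsub>P\<^esub> (tau x) = tau (sq\<^bsub>P\<^esub> x)" for x
    using assms by (cases x) (auto simp: P_squandle_def tau)
  have tau_r: "tau x = P_r \<longleftrightarrow> x = P_r" for x
    by (cases x) (simp_all add: tau)
  show ?thesis
    unfolding squandle_def
    by (simp add: car op tau sq_r sq_tau tau_r exI[of _ "lhd P"])
qed

end

theory Submission
  imports Defs
begin

text \<open>
  Squares determine everything. Axiom \<^prop>\<open>a \<triangleleft>\<^bsub>Q\<^esub> (sq\<^bsub>Q\<^esub> b) = (a \<triangleleft>\<^bsub>Q\<^esub> b) \<triangleleft>\<^bsub>Q\<^esub> b\<close> says that the square of \<open>b\<close>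
  acts by the square of the right translation by \<open>b\<close>, and the square of \<open>b\<close> is a fixed point of that
  translation. A non-trivially acting \<open>r\<close> therefore differs from its square \<open>s\<close>, so its translation
  has the two fixed points \<open>r\<close> and \<open>s\<close>. In a set of four elements only a transposition \<open>(p q)\<close>
  remains, and \<open>s\<close>, acting by the square of a transposition, acts trivially (lemma
  \<open>acts_as_transposition\<close>). In particular the four-element quandles in which an element acts
  by a 3-cycle carry no squaring.

  Now \<open>p\<close> and \<open>q\<close> are exchanged by \<open>r\<close>, so their actions are conjugate, and both are trivial or
  both are non-trivial. If both are trivial, then \<open>r\<close> is the only acting element, and the squares
  are restricted exactly as in \<open>P\<close>. If both are non-trivial, then \<open>s\<close> is the only trivially acting
  element; hence it is the square of each of \<open>p\<close>, \<open>q\<close>, \<open>r\<close>, each of which exchanges the other two.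
  These are the identity and the transpositions in the symmetric group on three letters.
\<close>

section \<open>Translations and squares\<close>

locale squandle_structure =
  fixes Q :: "'a squandle_sig" (structure)
  assumes squandle: "squandle Q"
begin

lemma lhd_closed [simp]: "a \<in> carrier Q \<Longrightarrow> b \<in> carrier Q \<Longrightarrow> a \<triangleleft> b \<in> carrier Q"
  and square_closed [simp]: "a \<in> carrier Q \<Longrightarrow> sq a \<in> carrier Q"
  and lhd_idem [simp]: "a \<in> carrier Q \<Longrightarrow> a \<triangleleft> a = a"
  and lhd_square: "a \<in> carrier Q \<Longrightarrow> b \<in> carrier Q \<Longrightarrow> a \<triangleleft> (sq b) = (a \<triangleleft> b) \<triangleleft> b"
  and square_lhd: "a \<in> carrier Q \<Longrightarrow> b \<in> carrier Q \<Longrightarrow> (sq a) \<triangleleft> b = sq (a \<triangleleft> b)"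
  using squandle unfolding squandle_def by (elim conjE; blast)+

lemma lhd_distrib:
  "a \<in> carrier Q \<Longrightarrow> b \<in> carrier Q \<Longrightarrow> c \<in> carrier Q \<Longrightarrow>
    (a \<triangleleft> b) \<triangleleft> c = (a \<triangleleft> c) \<triangleleft> (b \<triangleleft> c)"
  using squandle unfolding squandle_def by (elim conjE) blast

lemma bij_betw_translation:
  assumes "b \<in> carrier Q"
  shows "bij_betw (\<lambda>a. a \<triangleleft> b) (carrier Q) (carrier Q)"
proof -
  have "\<exists>rop. \<forall>a\<in>carrier Q. \<forall>b\<in>carrier Q.
      rop a b \<in> carrier Q \<and> rop (a \<triangleleft> b) b = a \<and> (rop a b) \<triangleleft> b = a"
    using squandle unfolding squandle_def by (elim conjE)
  then obtain rop where "\<forall>a\<in>carrier Q. \<forall>b\<in>carrier Q.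
      rop a b \<in> carrier Q \<and> rop (a \<triangleleft> b) b = a \<and> (rop a b) \<triangleleft> b = a" ..
  then have "rop a b \<in> carrier Q" "rop (a \<triangleleft> b) b = a" "(rop a b) \<triangleleft> b = a"
    if "a \<in> carrier Q" for a
    using that assms by simp_all
  then show ?thesis
    using assms by (intro bij_betwI[where g = "\<lambda>a. rop a b"]) auto
qed

lemma lhd_right_cancel [simp]:
  assumes "a \<in> carrier Q" "a' \<in> carrier Q" "b \<in> carrier Q"
  shows "a \<triangleleft> b = a' \<triangleleft> b \<longleftrightarrow> a = a'"
  using inj_on_eq_iff[OF bij_betw_imp_inj_on[OF bij_betw_translation[OF assms(3)]] assms(1,2)] .

lemma square_lhd_self: "a \<in> carrier Q \<Longrightarrow> sq a \<triangleleft> a = sq a"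
  by (simp add: square_lhd)

definition acts_trivially :: "'a \<Rightarrow> bool"
  where "acts_trivially b \<longleftrightarrow> (\<forall>a\<in>carrier Q. a \<triangleleft> b = a)"

lemma acts_trivially_square: "b \<in> carrier Q \<Longrightarrow> acts_trivially b \<Longrightarrow> acts_trivially (sq b)"
  by (simp add: acts_trivially_def lhd_square)

text \<open>Translation by \<open>b\<close> is then an idempotent permutation.\<close>

lemma idempotent_acts_trivially:
  assumes "b \<in> carrier Q" "sq b = b"
  shows "acts_trivially b"
  unfolding acts_trivially_def
proof
  fix a assume a: "a \<in> carrier Q"
  have "(a \<triangleleft> b) \<triangleleft> b = a \<triangleleft> b"
    using lhd_square[OF a assms(1)] unfolding assms(2) by (rule sym)
  then show "a \<triangleleft> b = a"
    using a assms(1) by simp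
qed

text \<open>
  Self-distributivity says that translation by \<open>b \<triangleleft> c\<close> is the conjugate of translation by \<open>b\<close>
  under the permutation given by \<open>c\<close>, and a conjugate of the identity is the identity.
\<close>

lemma acts_trivially_lhd:
  assumes "b \<in> carrier Q" "c \<in> carrier Q" "acts_trivially b"
  shows "acts_trivially (b \<triangleleft> c)"
  unfolding acts_trivially_def
proof
  fix a assume "a \<in> carrier Q"
  then obtain d where d: "d \<in> carrier Q" "a = d \<triangleleft> c"
    using bij_betw_translation[OF assms(2)] by (auto simp: bij_betw_def)
  then have "a \<triangleleft> (b \<triangleleft> c) = (d \<triangleleft> b) \<triangleleft> c"
    using lhd_distrib[OF d(1) assms(1,2)] by simp
  then show "a \<triangleleft> (b \<triangleleft> c) = a"
    using assms(3) d by (simp add: acts_trivially_def)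
qed

section \<open>Four elements: non-trivial actions are transpositions\<close>

text \<open>
  The square of \<open>r\<close> is a second fixed point of translation by \<open>r\<close>, so at most two elements are
  left to be moved, and they must be swapped.
\<close>

lemma acts_as_transposition:
  assumes card: "card (carrier Q) = 4" and r: "r \<in> carrier Q" and nontriv: "\<not> acts_trivially r"
  obtains p q where "carrier Q = {p, q, r, sq r}" "distinct [p, q, r, sq r]"
    "p \<triangleleft> r = q" "q \<triangleleft> r = p" "acts_trivially (sq r)"
proof -
  define s where "s = sq r"
  have s: "s \<in> carrier Q" "s \<triangleleft> r = s" "s \<noteq> r"
    using r nontriv idempotent_acts_trivially square_lhd_self by (auto simp: s_def)
  obtain p where p: "p \<in> carrier Q" "p \<triangleleft> r \<noteq> p"
    using nontriv by (auto simp: acts_trivially_def)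
  define q where "q = p \<triangleleft> r"
  have q: "q \<in> carrier Q" "q \<noteq> p"
    using p r by (auto simp: q_def)
  have p_new: "p \<noteq> r" "p \<noteq> s"
    using p r s by auto
  have q_new: "q \<noteq> r" "q \<noteq> s"
    using lhd_right_cancel[of p r r] lhd_right_cancel[of p s r] p r s p_new by (auto simp: q_def)
  have dist: "distinct [p, q, r, s]"
    using q p_new q_new s by auto
  have "finite (carrier Q)"
    using card card.infinite by fastforce
  moreover have "{p, q, r, s} \<subseteq> carrier Q"
    using p(1) q(1) r s(1) by simp
  moreover have "card {p, q, r, s} = card (carrier Q)"
    using dist card by simp
  ultimately have car: "carrier Q = {p, q, r, s}"
    using card_subset_eq by metis
  have "q \<triangleleft> r \<in> {p, q, r, s}"
    using lhd_closed[OF q(1) r] unfolding car .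
  moreover have "q \<triangleleft> r \<noteq> q" "q \<triangleleft> r \<noteq> r" "q \<triangleleft> r \<noteq> s"
    using lhd_right_cancel[of q p r] lhd_right_cancel[of q r r] lhd_right_cancel[of q s r]
      p q r s q_new by (auto simp flip: q_def)
  ultimately have qr: "q \<triangleleft> r = p"
    by simp
  have s_triv: "acts_trivially s"
    unfolding acts_trivially_def
  proof
    fix a assume a: "a \<in> carrier Q"
    then have "a \<triangleleft> s = (a \<triangleleft> r) \<triangleleft> r"
      using r by (simp add: s_def lhd_square)
    also have "\<dots> = a"
      using a qr r s(2) q_def by (auto simp: car)
    finally show "a \<triangleleft> s = a" .
  qed
  show ?thesis
    using car dist q_def[symmetric] qr s_triv by (rule that[folded s_def])
qed

section \<open>A single acting element\<close>

text \<open>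
  Since \<open>r\<close> is the only acting element, squares of the other elements differ from \<open>r\<close>. With
  \<open>s = sq r\<close>, the square of \<open>s\<close> is moreover fixed by \<open>r\<close>, which leaves only \<open>s\<close>; and \<open>r\<close>, acting
  by an automorphism, carries \<open>sq q\<close> to \<open>sq p\<close>, so that \<open>sq q\<close> can be any of \<open>p\<close>, \<open>q\<close>, \<open>s\<close>.
\<close>

lemma isomorphic_P_if_one_acts:
  assumes car: "carrier Q = {p, q, r, sq r}" and dist: "distinct [p, q, r, sq r]"
    and pr: "p \<triangleleft> r = q" and qr: "q \<triangleleft> r = p"
    and triv: "acts_trivially p" "acts_trivially q" "acts_trivially (sq r)"
  shows "\<exists>P. P_squandle P \<and> squandle_isomorphic Q P"
proof -
  define s where "s = sq r"
  note car = car[folded s_def] and dist = dist[folded s_def] and triv = triv[folded s_def]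
  have in_car: "p \<in> carrier Q" "q \<in> carrier Q" "r \<in> carrier Q" "s \<in> carrier Q"
    by (simp_all add: car)
  have lhd_p: "a \<triangleleft> p = a" and lhd_q: "a \<triangleleft> q = a" and lhd_s: "a \<triangleleft> s = a" if "a \<in> carrier Q" for a
    using that triv by (auto simp: acts_trivially_def)
  have sr: "s \<triangleleft> r = s"
    using in_car by (simp add: s_def square_lhd)
  have r_acts: "\<not> acts_trivially r"
    using in_car pr dist unfolding acts_trivially_def by fastforce
  have sq_s: "sq s = s"
  proof -
    have "sq s \<in> {p, q, r, s}"
      using in_car square_closed[of s] car by simp
    moreover have "sq s \<noteq> r"
      using acts_trivially_square[of s] in_car triv r_acts by auto
    moreover have "sq s \<triangleleft> r = sq s"
      using in_car sr by (simp add: square_lhd)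
    then have "sq s \<noteq> p" "sq s \<noteq> q"
      using pr qr dist by auto
    ultimately show ?thesis
      by simp
  qed
  have sq_q: "sq q \<in> {p, q, s}"
  proof -
    have "sq q \<noteq> r"
      using acts_trivially_square[of q] in_car triv r_acts by auto
    then show ?thesis
      using in_car square_closed[of q] car by auto
  qed
  have sq_p: "sq p = sq q \<triangleleft> r"
    using in_car qr by (simp add: square_lhd)
  define f where "f a = (if a = p then P_p else if a = q then P_q else if a = r then P_r else P_s)"
    for a
  define g where "g x = (case x of P_p \<Rightarrow> p | P_q \<Rightarrow> q | P_r \<Rightarrow> r | P_s \<Rightarrow> s)" for x
  have f: "f p = P_p" "f q = P_q" "f r = P_r" "f s = P_s"
    using dist by (auto simp: f_def)
  have g: "g P_p = p" "g P_q = q" "g P_r = r" "g P_s = s"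
    by (simp_all add: g_def)
  have gf: "g (f a) = a" if "a \<in> carrier Q" for a
    using that by (auto simp: car f g)
  have fg: "f (g x) = x" and g_car: "g x \<in> carrier Q" for x
    by (cases x; simp add: f g in_car)+
  have univ: "UNIV = {P_p, P_q, P_r, P_s}"
    using P_elem.exhaust by auto
  \<comment> \<open>The structure of \<open>Q\<close> transported along \<open>f\<close>.\<close>
  define P :: "P_elem squandle_sig" where
    "P = \<lparr>carrier = UNIV, lhd = \<lambda>x y. f (g x \<triangleleft> g y), square = \<lambda>x. f (sq (g x))\<rparr>"
  have "f (sq q) \<in> {P_p, P_q, P_s}" "f (sq p) = tau (f (sq q))"
    using sq_q unfolding sq_p
    by (elim insertE emptyE; simp add: f pr qr sr tau_def)+
  then have "P_squandle P"
    unfolding P_squandle_def P_def univ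
    by (simp add: f g lhd_p lhd_q lhd_s in_car pr qr sr sq_s tau_def flip: s_def)
  moreover have "f \<in> squandle_iso Q P"
    using gf fg g_car
    by (auto simp: squandle_iso_def P_def intro!: bij_betwI[where g = g])
  ultimately show ?thesis
    by (auto simp: squandle_isomorphic_def)
qed

end

section \<open>Three acting elements\<close>

text \<open>The elements other than the identity are involutions, so conjugation needs no inverses here.\<close>

lemma S3_2_simps:
  "carrier S3_2 = {id, transpose 1 2, transpose 2 3, transpose 1 3}"
  "b \<in> carrier S3_2 \<Longrightarrow> a \<triangleleft>\<^bsub>S3_2\<^esub> b = b \<circ> a \<circ> b"
  "sq\<^bsub>S3_2\<^esub> a = a \<circ> a"
proof -
  interpret group "sym_group 3" by (rule sym_group_is_group)
  show car: "carrier S3_2 = {id, transpose 1 2, transpose 2 3, transpose 1 3}"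
    by (simp add: S3_2_def)
  show "sq\<^bsub>S3_2\<^esub> a = a \<circ> a"
    by (simp add: S3_2_def group_squandle_def sym_group_mult)
  assume b: "b \<in> carrier S3_2"
  then have "b \<in> carrier (sym_group 3)"
    using sub_squandle_S3_2 by (auto simp: sub_squandle_def group_squandle_def)
  moreover have "b \<circ> b = id"
    using b by (auto simp: car)
  ultimately have "inv\<^bsub>sym_group 3\<^esub> b = b"
    by (intro inv_equality) (auto simp: sym_group_mult sym_group_one)
  then show "a \<triangleleft>\<^bsub>S3_2\<^esub> b = b \<circ> a \<circ> b"
    by (simp add: S3_2_def group_squandle_def sym_group_mult)
qed

context squandle_structure
begin

text \<open>
  Any assignment of the three transpositions to \<open>p\<close>, \<open>q\<close>, \<open>r\<close> works: on both sides, each of the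
  three elements exchanges the other two and has the fourth one as its square.
\<close>

lemma isomorphic_S3_2_if_three_act:
  assumes car: "carrier Q = {p, q, r, s}" and dist: "distinct [p, q, r, s]"
    and ops: "p \<triangleleft> q = r" "r \<triangleleft> q = p" "q \<triangleleft> p = r" "r \<triangleleft> p = q" "p \<triangleleft> r = q" "q \<triangleleft> r = p"
    and squares: "sq p = s" "sq q = s" "sq r = s" "sq s = s"
    and s_triv: "acts_trivially s"
  shows "squandle_isomorphic Q S3_2"
proof -
  have in_car: "p \<in> carrier Q" "q \<in> carrier Q" "r \<in> carrier Q" "s \<in> carrier Q"
    by (simp_all add: car)
  have lhd_s: "a \<triangleleft> s = a" if "a \<in> carrier Q" for a
    using that s_triv by (auto simp: acts_trivially_def)
  have s_fixed: "s \<triangleleft> p = s" "s \<triangleleft> q = s" "s \<triangleleft> r = s"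
    using in_car squares square_lhd_self by metis+
  define f :: "'a \<Rightarrow> nat \<Rightarrow> nat" where
    "f a = (if a = p then transpose 1 2 else if a = q then transpose 2 3
            else if a = r then transpose 1 3 else id)" for a
  have f: "f p = transpose 1 2" "f q = transpose 2 3" "f r = transpose 1 3" "f s = id"
    using dist by (auto simp: f_def)
  have neq: "transpose 1 2 \<noteq> transpose 2 (3::nat)" "transpose 1 2 \<noteq> transpose 1 (3::nat)"
    "transpose 2 3 \<noteq> transpose 1 (3::nat)" "transpose 1 2 \<noteq> (id :: nat \<Rightarrow> nat)"
    "transpose 2 3 \<noteq> (id :: nat \<Rightarrow> nat)" "transpose 1 3 \<noteq> (id :: nat \<Rightarrow> nat)"
    by (simp_all add: transpose_eq_id_iff)
      (auto dest: fun_cong[of _ _ 1] simp: transpose_def)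
  have bij: "bij_betw f (carrier Q) (carrier S3_2)"
    unfolding bij_betw_def inj_on_def car S3_2_simps(1)
    using neq neq[symmetric] by (auto simp: f)
  have conj:
    "transpose 1 2 \<circ> transpose 2 3 \<circ> transpose 1 2 = transpose 1 (3::nat)"
    "transpose 1 2 \<circ> transpose 1 3 \<circ> transpose 1 2 = transpose 2 (3::nat)"
    "transpose 2 3 \<circ> transpose 1 2 \<circ> transpose 2 3 = transpose 1 (3::nat)"
    "transpose 2 3 \<circ> transpose 1 3 \<circ> transpose 2 3 = transpose 1 (2::nat)"
    "transpose 1 3 \<circ> transpose 1 2 \<circ> transpose 1 3 = transpose 2 (3::nat)"
    "transpose 1 3 \<circ> transpose 2 3 \<circ> transpose 1 3 = transpose 1 (2::nat)"
    by (simp_all add: fun_eq_iff transpose_def)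
  have lhd: "f (a \<triangleleft> b) = f b \<circ> f a \<circ> f b" if "a \<in> {p, q, r, s}" "b \<in> {p, q, r, s}" for a b
    using that by (elim insertE emptyE; hypsubst;
        simp only: f conj ops s_fixed lhd_s lhd_idem in_car transpose_comp_involutory comp_id id_comp)
  have square: "f (sq a) = f a \<circ> f a" if "a \<in> {p, q, r, s}" for a
    using that by (auto simp: f squares)
  have "f a \<in> carrier S3_2" if "a \<in> carrier Q" for a
    using that bij by (auto simp: bij_betw_def)
  then have "f \<in> squandle_iso Q S3_2"
    using bij by (simp add: squandle_iso_def S3_2_simps(2,3) lhd[folded car] square[folded car])
  then show ?thesis
    by (auto simp: squandle_isomorphic_def)
qed

end

section \<open>The classification\<close>

theorem proposition5p13:
  fixes Q :: "'a squandle_sig"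
  assumes "squandle Q" and "card (carrier Q) = 4" and "\<not> trivial_squandle Q"
  shows "squandle_isomorphic Q S3_2 \<or> (\<exists>P. P_squandle P \<and> squandle_isomorphic Q P)"
proof -
  interpret squandle_structure Q
    by unfold_locales fact
  note swap = acts_as_transposition[OF assms(2)]
  obtain r where r: "r \<in> carrier Q" "\<not> acts_trivially r"
    using assms(3) by (auto simp: trivial_squandle_def acts_trivially_def)
  define s where "s = sq\<^bsub>Q\<^esub> r"
  obtain p q where car: "carrier Q = {p, q, r, s}" and dist: "distinct [p, q, r, s]"
    and pr: "p \<triangleleft>\<^bsub>Q\<^esub> r = q" and qr: "q \<triangleleft>\<^bsub>Q\<^esub> r = p" and s_triv: "acts_trivially s"
    using swap[OF r] unfolding s_def by blast
  have in_car: "p \<in> carrier Q" "q \<in> carrier Q" "s \<in> carrier Q"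
    by (simp_all add: car)
  have pq: "acts_trivially p \<longleftrightarrow> acts_trivially q"
    using acts_trivially_lhd[of p r] acts_trivially_lhd[of q r] in_car r pr qr by auto
  show ?thesis
  proof (cases "acts_trivially p")
    case True
    then have "\<exists>P. P_squandle P \<and> squandle_isomorphic Q P"
      using isomorphic_P_if_one_acts[of p q r, folded s_def, OF car dist pr qr _ _ s_triv] pq by blast
    then show ?thesis ..
  next
    case False
    have only_s: "a = s" if "a \<in> carrier Q" "acts_trivially a" for a
      using that False pq r car by auto
    \<comment> \<open>A non-trivially acting element has square \<open>s\<close> and exchanges the two elements other than
      itself and \<open>s\<close>.\<close>
    have exchange: "sq\<^bsub>Q\<^esub> a = s \<and> b \<triangleleft>\<^bsub>Q\<^esub> a = c \<and> c \<triangleleft>\<^bsub>Q\<^esub> a = b"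
      if abc: "carrier Q = {b, c, a, s}" "distinct [b, c, a, s]" "\<not> acts_trivially a" for a b c
    proof -
      have a: "a \<in> carrier Q"
        using abc(1) by simp
      obtain x y where xy: "carrier Q = {x, y, a, sq\<^bsub>Q\<^esub> a}" "distinct [x, y, a, sq\<^bsub>Q\<^esub> a]"
        "x \<triangleleft>\<^bsub>Q\<^esub> a = y" "y \<triangleleft>\<^bsub>Q\<^esub> a = x" "acts_trivially (sq\<^bsub>Q\<^esub> a)"
        using swap[OF a abc(3)] by blast
      have sq_a: "sq\<^bsub>Q\<^esub> a = s"
        by (rule only_s[OF square_closed[OF a] xy(5)])
      have "{x, y, a, s} = {b, c, a, s}"
        using xy(1) abc(1) sq_a by simp
      then have "x = b \<and> y = c \<or> x = c \<and> y = b"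
        using xy(2) abc(2) sq_a by auto
      then show ?thesis
        using xy(3,4) sq_a by auto
    qed
    have p_ops: "sq\<^bsub>Q\<^esub> p = s \<and> q \<triangleleft>\<^bsub>Q\<^esub> p = r \<and> r \<triangleleft>\<^bsub>Q\<^esub> p = q"
      using car dist False by (intro exchange) auto
    have q_ops: "sq\<^bsub>Q\<^esub> q = s \<and> p \<triangleleft>\<^bsub>Q\<^esub> q = r \<and> r \<triangleleft>\<^bsub>Q\<^esub> q = p"
      using car dist False pq by (intro exchange) auto
    have sq_s: "sq\<^bsub>Q\<^esub> s = s"
      using in_car s_triv by (intro only_s acts_trivially_square square_closed)
    have "squandle_isomorphic Q S3_2"
      by (rule isomorphic_S3_2_if_three_act[OF car dist _ _ _ _ pr qr _ _ s_def[symmetric] sq_s s_triv])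
        (use p_ops q_ops in blast)+
    then show ?thesis ..
  qed
qed

end
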